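(* Let $F$ be a field of characteristic $\neq 2$, let $r\ge 0$, $s>0$ be integers and $n=r+s$. Let $\beta:F^n\to F^n$ be the linear map such that $\beta(e_i)=e_i$ for $1\le i\le r$ and $\beta(e_{r+j})=-e_{r+j}$ for $1\le j\le s$. Then $\beta$ extends to an algebra automorphism of $C\ell(r,s)$.
   Context: $e_1,\dots,e_n$ is the canonical basis of $F^n$, and $Q$ is the symmetric bilinear form on $F^n$ with $Q(e_i,e_j)=0$ for $i\ne j$, $Q(e_i,e_i)=1$ for $1\le i\le r$, and $Q(e_i,e_i)=-1$ for $r+1\le i\le r+s$. $C\ell(r,s)$ is the Clifford algebra over $F$ determined by $F^n$ and $Q$, with the sign convention $v\cdot v=-Q(v,v)1$ for $v\in F^n\subset C\ell(r,s)$. *)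

theory Defs
  imports "HOL-Library.Poly_Mapping" "HOL-Algebra.QuotRing" "Jordan_Normal_Form.VS_Connect"
begin

text \<open>
  \<open>F\<^sup>n\<close> is the space \<open>module_vec TYPE('a) n\<close> of vectors of dimension \<open>n\<close>.
  Indices start at 0: the canonical basis \<open>e\<^sub>1, \<dots>, e\<^sub>n\<close> is
  \<open>unit_vec n 0, \<dots>, unit_vec n (n - 1)\<close>.
\<close>

definition bilin_form :: "nat \<Rightarrow> nat \<Rightarrow> 'a::field vec \<Rightarrow> 'a vec \<Rightarrow> 'a" where
  "bilin_form r s v w = (\<Sum>i<r. v $ i * w $ i) - (\<Sum>i = r..<r + s. v $ i * w $ i)"

text \<open>The form above is the symmetric bilinear form with the prescribed values on the basis.\<close>

lemma bilin_form_unit_vec: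
  assumes "i < r + s" "j < r + s"
  shows "bilin_form r s (unit_vec (r + s) i) (unit_vec (r + s) j :: 'a::field vec) =
    (if i \<noteq> j then 0 else if i < r then 1 else - 1)"
proof -
  have "unit_vec (r + s) i $ k * unit_vec (r + s) j $ k = (if k = i then if i = j then 1 else 0 else 0 :: 'a)"
    if "k < r + s" for k
    using assms that by auto
  then show ?thesis
    using assms by (auto simp: bilin_form_def sum.delta)
qed

lemma bilin_form_sym: "bilin_form r s v w = bilin_form r s w v"
  by (simp add: bilin_form_def mult.commute)

lemma bilin_form_add:
  assumes "u \<in> carrier_vec (r + s)" "v \<in> carrier_vec (r + s)"
  shows "bilin_form r s (u + v) w = bilin_form r s u w + bilin_form r s v w"
  using assms by (simp add: bilin_form_def distrib_right sum.distrib)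

lemma bilin_form_smult:
  assumes "v \<in> carrier_vec (r + s)"
  shows "bilin_form r s (c \<cdot>\<^sub>v v) w = c * bilin_form r s v w"
  using assms by (simp add: bilin_form_def right_diff_distrib sum_distrib_left mult.assoc)

text \<open>
  The free monoid on the letters \<open>0, 1, 2, \<dots>\<close>, written additively so that the product of
  \<^typ>\<open>'b \<Rightarrow>\<^sub>0 'a\<close> is the (noncommutative) monoid algebra product.
\<close>

datatype word = Word (letters: "nat list")

instantiation word :: monoid_add
begin

definition zero_word :: word where "0 = Word []"

definition plus_word :: "word \<Rightarrow> word \<Rightarrow> word" where
  "u + v = Word (letters u @ letters v)"

instance
  by standard (simp_all add: zero_word_def plus_word_def)

end

text \<open>
  The tensor algebra \<open>T(F\<^sup>n)\<close>: the word with letters \<open>i, j, \<dots>, k < n\<close> stands for the basis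
  element \<open>e\<^sub>i \<otimes> e\<^sub>j \<otimes> \<dots> \<otimes> e\<^sub>k\<close>, so an element is a finitely supported function on such words.
\<close>

definition tensor_algebra :: "'a::field itself \<Rightarrow> nat \<Rightarrow> ('a, word \<Rightarrow>\<^sub>0 'a) module" where
  "tensor_algebra ty n =
    \<lparr>carrier = {x. \<forall>w \<in> Poly_Mapping.keys x. set (letters w) \<subseteq> {..<n}},
     mult = (*), one = 1, zero = 0, add = (+),
     smult = (\<lambda>c. Poly_Mapping.map ((*) c))\<rparr>"

definition tensor_vec :: "'a::field vec \<Rightarrow> word \<Rightarrow>\<^sub>0 'a" where
  "tensor_vec v = (\<Sum>i<dim_vec v. Poly_Mapping.single (Word [i]) (v $ i))"

definition clifford_ideal :: "'a::field itself \<Rightarrow> nat \<Rightarrow> nat \<Rightarrow> (word \<Rightarrow>\<^sub>0 'a) set" where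
  "clifford_ideal ty r s =
    (let T = tensor_algebra ty (r + s) in
      Idl\<^bsub>T\<^esub> {tensor_vec v \<otimes>\<^bsub>T\<^esub> tensor_vec v \<oplus>\<^bsub>T\<^esub> bilin_form r s v v \<odot>\<^bsub>T\<^esub> \<one>\<^bsub>T\<^esub> | v.
        v \<in> carrier_vec (r + s)})"

text \<open>
  The quotient \<open>T(F\<^sup>n) / (v \<otimes> v + Q(v,v) 1)\<close>. The scalar action on cosets is defined like
  \<^const>\<open>rcoset_mult\<close>.
\<close>

definition clifford_algebra :: "'a::field itself \<Rightarrow> nat \<Rightarrow> nat \<Rightarrow> ('a, (word \<Rightarrow>\<^sub>0 'a) set) module" where
  "clifford_algebra ty r s =
    (let T = tensor_algebra ty (r + s); I = clifford_ideal ty r s in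
      ring.extend (T Quot I)
        (module.fields (\<lambda>c X. \<Union>x\<in>X. I +>\<^bsub>T\<^esub> (c \<odot>\<^bsub>T\<^esub> x))))"

text \<open>The canonical map \<open>F\<^sup>n \<rightarrow> C\<ell>(r,s)\<close>, by which \<open>F\<^sup>n\<close> is regarded as a subspace.\<close>

definition clifford_vec :: "nat \<Rightarrow> nat \<Rightarrow> 'a::field vec \<Rightarrow> (word \<Rightarrow>\<^sub>0 'a) set" where
  "clifford_vec r s v =
    clifford_ideal TYPE('a) r s +>\<^bsub>tensor_algebra TYPE('a) (r + s)\<^esub> tensor_vec v"


text \<open>
  Well-definedness: the Clifford algebra is a ring and an \<open>F\<close>-vector space with compatible
  multiplications, and \<open>v \<cdot> v = - Q(v,v) 1\<close> holds in it.
\<close>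

lemma map_mult_eq: "Poly_Mapping.map ((*) c) x = Poly_Mapping.single 0 c * x"
  for x :: "word \<Rightarrow>\<^sub>0 'a::field"
proof (rule poly_mapping_eqI)
  fix w :: word
  have "(\<Sum>l. Poly_Mapping.lookup (Poly_Mapping.single 0 c) l * (\<Sum>q. Poly_Mapping.lookup x q when w = l + q)) =
      (\<Sum>l. (c * (\<Sum>q. Poly_Mapping.lookup x q when w = l + q)) when l = 0)"
    by (rule Sum_any.cong) (auto simp: lookup_single when_def)
  also have "\<dots> = c * Poly_Mapping.lookup x w"
    by simp
  finally show "Poly_Mapping.lookup (Poly_Mapping.map ((*) c) x) w = Poly_Mapping.lookup (Poly_Mapping.single 0 c * x) w"
    by (simp add: lookup_mult map.rep_eq when_def)
qed

lemma single_0_commute: "Poly_Mapping.single 0 c * x = x * Poly_Mapping.single 0 c"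
  for x :: "word \<Rightarrow>\<^sub>0 'a::field"
proof (rule poly_mapping_eqI)
  fix w :: word
  have *: "(\<Sum>q. Poly_Mapping.lookup (Poly_Mapping.single 0 c) q when w = l + q) = (c when l = w)" for l
  proof -
    have "(\<Sum>q. Poly_Mapping.lookup (Poly_Mapping.single 0 c) q when w = l + q) = (\<Sum>q::word. (c when l = w) when q = 0)"
      by (rule Sum_any.cong) (auto simp: lookup_single when_def)
    then show ?thesis by simp
  qed
  have "Poly_Mapping.lookup (x * Poly_Mapping.single 0 c) w = (\<Sum>l. (Poly_Mapping.lookup x l * c) when l = w)"
    by (simp add: lookup_mult * mult_when)
  also have "\<dots> = c * Poly_Mapping.lookup x w"
    by (simp add: mult.commute)
  finally show "Poly_Mapping.lookup (Poly_Mapping.single 0 c * x) w = Poly_Mapping.lookup (x * Poly_Mapping.single 0 c) w"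
    by (simp add: map_mult_eq[symmetric] map.rep_eq when_def)
qed

lemma tensor_algebra_simps:
  "carrier (tensor_algebra ty n) = {x. \<forall>w \<in> Poly_Mapping.keys x. set (letters w) \<subseteq> {..<n}}"
  "monoid.mult (tensor_algebra ty n) = (*)"
  "one (tensor_algebra ty n) = 1"
  "zero (tensor_algebra ty n) = 0"
  "add (tensor_algebra ty n) = (+)"
  "module.smult (tensor_algebra ty n) c x = Poly_Mapping.single 0 c * x"
  by (simp_all add: tensor_algebra_def map_mult_eq)

lemma tensor_algebra_mult_closed:
  assumes "x \<in> carrier (tensor_algebra ty n)" "y \<in> carrier (tensor_algebra ty n)"
  shows "x * y \<in> carrier (tensor_algebra ty n)"
  using assms keys_mult[of x y] by (fastforce simp: tensor_algebra_simps plus_word_def)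

lemma tensor_algebra_scalar: "Poly_Mapping.single 0 c \<in> carrier (tensor_algebra ty n)"
  by (simp add: tensor_algebra_simps zero_word_def)

lemma tensor_algebra_ring: "ring (tensor_algebra ty n)"
proof (rule ringI)
  show "abelian_group (tensor_algebra ty n)"
  proof (rule abelian_groupI)
    fix x y assume "x \<in> carrier (tensor_algebra ty n)" "y \<in> carrier (tensor_algebra ty n)"
    then show "x \<oplus>\<^bsub>tensor_algebra ty n\<^esub> y \<in> carrier (tensor_algebra ty n)"
      using keys_add[of x y] by (fastforce simp: tensor_algebra_simps)
  next
    fix x assume "x \<in> carrier (tensor_algebra ty n)"
    then show "\<exists>y\<in>carrier (tensor_algebra ty n).
        y \<oplus>\<^bsub>tensor_algebra ty n\<^esub> x = \<zero>\<^bsub>tensor_algebra ty n\<^esub>"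
      by (intro bexI[of _ "- x"]) (auto simp: tensor_algebra_simps in_keys_iff)
  qed (auto simp: tensor_algebra_simps add_ac)
  show "Group.monoid (tensor_algebra ty n)"
  proof (rule monoidI)
    fix x y assume "x \<in> carrier (tensor_algebra ty n)" "y \<in> carrier (tensor_algebra ty n)"
    then show "x \<otimes>\<^bsub>tensor_algebra ty n\<^esub> y \<in> carrier (tensor_algebra ty n)"
      unfolding tensor_algebra_simps(2) by (rule tensor_algebra_mult_closed)
  qed (auto simp: tensor_algebra_simps zero_word_def mult.assoc)
qed (auto simp: tensor_algebra_simps algebra_simps)

lemma tensor_vec_closed:
  assumes "v \<in> carrier_vec n"
  shows "tensor_vec v \<in> carrier (tensor_algebra ty n)"
proof -
  have "Poly_Mapping.keys (tensor_vec v) \<subseteq>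
      (\<Union>i<dim_vec v. Poly_Mapping.keys (Poly_Mapping.single (Word [i]) (v $ i)))"
    unfolding tensor_vec_def by (rule keys_sum)
  also have "\<dots> \<subseteq> (\<Union>i<n. {Word [i]})"
    using assms by auto
  finally show ?thesis
    by (auto simp: tensor_algebra_simps)
qed

lemma clifford_ideal: "ideal (clifford_ideal ty r s) (tensor_algebra ty (r + s))"
proof -
  interpret ring "tensor_algebra ty (r + s)" by (rule tensor_algebra_ring)
  show ?thesis
    unfolding clifford_ideal_def Let_def
  proof (rule genideal_ideal, clarify)
    fix v :: "'a vec" assume "v \<in> carrier_vec (r + s)"
    then have "tensor_vec v \<in> carrier (tensor_algebra ty (r + s))"
      by (rule tensor_vec_closed)
    moreover have "bilin_form r s v v \<odot>\<^bsub>tensor_algebra ty (r + s)\<^esub> \<one>\<^bsub>tensor_algebra ty (r + s)\<^esub>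
        \<in> carrier (tensor_algebra ty (r + s))"
      using tensor_algebra_scalar[of "bilin_form r s v v" ty "r + s"] by (simp add: tensor_algebra_simps(3,6))
    ultimately show "tensor_vec v \<otimes>\<^bsub>tensor_algebra ty (r + s)\<^esub> tensor_vec v \<oplus>\<^bsub>tensor_algebra ty (r + s)\<^esub>
        bilin_form r s v v \<odot>\<^bsub>tensor_algebra ty (r + s)\<^esub> \<one>\<^bsub>tensor_algebra ty (r + s)\<^esub>
        \<in> carrier (tensor_algebra ty (r + s))"
      by (intro a_closed m_closed)
  qed
qed

lemma clifford_algebra_simps:
  fixes ty :: "'a::field itself"
  shows "carrier (clifford_algebra ty r s) = carrier (tensor_algebra ty (r + s) Quot clifford_ideal ty r s)"
    "monoid.mult (clifford_algebra ty r s) = monoid.mult (tensor_algebra ty (r + s) Quot clifford_ideal ty r s)"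
    "one (clifford_algebra ty r s) = one (tensor_algebra ty (r + s) Quot clifford_ideal ty r s)"
    "zero (clifford_algebra ty r s) = zero (tensor_algebra ty (r + s) Quot clifford_ideal ty r s)"
    "add (clifford_algebra ty r s) = add (tensor_algebra ty (r + s) Quot clifford_ideal ty r s)"
  by (simp_all add: clifford_algebra_def Let_def ring.defs)

lemma clifford_algebra_ring: "ring (clifford_algebra ty r s)"
proof -
  interpret R: ring "tensor_algebra ty (r + s) Quot clifford_ideal ty r s"
    by (rule ideal.quotient_is_ring[OF clifford_ideal])
  show ?thesis
  proof (rule ringI)
    show "abelian_group (clifford_algebra ty r s)"
      by (rule abelian_groupI) (use R.l_neg R.a_inv_closed in
        \<open>auto simp: clifford_algebra_simps R.a_assoc R.a_comm R.a_lcomm\<close>)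
    show "Group.monoid (clifford_algebra ty r s)"
      by (rule monoidI) (auto simp: clifford_algebra_simps R.m_assoc)
  qed (auto simp: clifford_algebra_simps R.l_distr R.r_distr)
qed

context
  fixes ty :: "'a::field itself" and r s :: nat
begin

private abbreviation (input) "T \<equiv> tensor_algebra ty (r + s)"
private abbreviation (input) "C \<equiv> clifford_algebra ty r s"
private abbreviation (input) "proj x \<equiv> clifford_ideal ty r s +>\<^bsub>T\<^esub> x"

interpretation T: ring T by (rule tensor_algebra_ring)
interpretation I: ideal "clifford_ideal ty r s" T by (rule clifford_ideal)

lemma clifford_carrierE:
  assumes "X \<in> carrier C"
  obtains x where "x \<in> carrier T" "X = proj x"
  using assms by (auto simp: clifford_algebra_simps FactRing_simps)

lemma clifford_proj_closed: "x \<in> carrier T \<Longrightarrow> proj x \<in> carrier C"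
  by (auto simp: clifford_algebra_simps FactRing_simps)

lemma clifford_proj_add: "x \<in> carrier T \<Longrightarrow> y \<in> carrier T \<Longrightarrow> proj x \<oplus>\<^bsub>C\<^esub> proj y = proj (x + y)"
  using I.a_rcos_sum[of x y] by (simp add: clifford_algebra_simps FactRing_def tensor_algebra_simps)

lemma clifford_proj_mult: "x \<in> carrier T \<Longrightarrow> y \<in> carrier T \<Longrightarrow> proj x \<otimes>\<^bsub>C\<^esub> proj y = proj (x * y)"
  using I.rcoset_mult_add[of x y] by (simp add: clifford_algebra_simps FactRing_def tensor_algebra_simps)

lemma clifford_proj_one: "\<one>\<^bsub>C\<^esub> = proj 1"
  by (simp add: clifford_algebra_simps FactRing_def tensor_algebra_simps)

lemma clifford_proj_smult:
  assumes x: "x \<in> carrier T"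
  shows "c \<odot>\<^bsub>C\<^esub> proj x = proj (Poly_Mapping.single 0 c * x)"
proof -
  have "proj (Poly_Mapping.single 0 c * y) = proj (Poly_Mapping.single 0 c * x)" if "y \<in> proj x" for y
  proof -
    have c: "Poly_Mapping.single 0 c \<in> carrier T"
      by (rule tensor_algebra_scalar)
    have y: "y \<in> carrier T"
      using that x I.a_subset T.a_r_coset_subset_G by blast
    have "proj y = proj x"
      using that x by (metis T.a_repr_independence I.a_subgroup)
    then show ?thesis
      using clifford_proj_mult[OF c y] clifford_proj_mult[OF c x] by simp
  qed
  moreover have "proj x \<noteq> {}"
    using I.a_rcos_self[OF x] by auto
  ultimately show ?thesis
    by (auto simp: clifford_algebra_def Let_def ring.defs module.defs tensor_algebra_simps)
qed

lemma clifford_algebra_smult_mult: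
  assumes "X \<in> carrier C" "Y \<in> carrier C"
  shows "(c \<odot>\<^bsub>C\<^esub> X) \<otimes>\<^bsub>C\<^esub> Y = c \<odot>\<^bsub>C\<^esub> (X \<otimes>\<^bsub>C\<^esub> Y)" "X \<otimes>\<^bsub>C\<^esub> (c \<odot>\<^bsub>C\<^esub> Y) = c \<odot>\<^bsub>C\<^esub> (X \<otimes>\<^bsub>C\<^esub> Y)"
proof -
  obtain x y where xy: "x \<in> carrier T" "X = proj x" "y \<in> carrier T" "Y = proj y"
    using assms clifford_carrierE by metis
  note closed = tensor_algebra_scalar[of c ty "r + s"] tensor_algebra_mult_closed
  show "(c \<odot>\<^bsub>C\<^esub> X) \<otimes>\<^bsub>C\<^esub> Y = c \<odot>\<^bsub>C\<^esub> (X \<otimes>\<^bsub>C\<^esub> Y)"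
    using xy by (simp add: closed clifford_proj_smult clifford_proj_mult mult.assoc)
  show "X \<otimes>\<^bsub>C\<^esub> (c \<odot>\<^bsub>C\<^esub> Y) = c \<odot>\<^bsub>C\<^esub> (X \<otimes>\<^bsub>C\<^esub> Y)"
    using xy by (simp add: closed clifford_proj_smult clifford_proj_mult single_0_commute mult.assoc)
qed

lemma clifford_algebra_vectorspace: "vectorspace class_ring C"
proof -
  interpret C: ring C by (rule clifford_algebra_ring)
  have field: "field (class_ring :: 'a ring)"
    using class_field unfolding class_field_def .
  note closed = tensor_algebra_scalar[of _ ty "r + s"] tensor_algebra_mult_closed
  have add_closed: "x + y \<in> carrier T" if "x \<in> carrier T" "y \<in> carrier T" for x y
    using T.a_closed[OF that] by (simp only: tensor_algebra_simps(5))
  have "Module.module (class_ring :: 'a ring) C"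
  proof (rule moduleI)
    show "cring (class_ring :: 'a ring)"
      using field by (rule fieldE(1))
    show "abelian_group C"
      by (rule C.abelian_group_axioms)
  next
    fix a b :: 'a and X Y assume "X \<in> carrier C" "Y \<in> carrier C"
    then obtain x y where xy: "x \<in> carrier T" "X = proj x" "y \<in> carrier T" "Y = proj y"
      using clifford_carrierE by metis
    show "a \<odot>\<^bsub>C\<^esub> (X \<oplus>\<^bsub>C\<^esub> Y) = a \<odot>\<^bsub>C\<^esub> X \<oplus>\<^bsub>C\<^esub> a \<odot>\<^bsub>C\<^esub> Y"
      using xy by (simp add: closed add_closed clifford_proj_smult clifford_proj_add distrib_left)
  next
    fix a b :: 'a and X assume "X \<in> carrier C"
    then obtain x where x: "x \<in> carrier T" "X = proj x"
      using clifford_carrierE by metis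
    show "a \<odot>\<^bsub>C\<^esub> X \<in> carrier C"
      using x by (simp add: closed clifford_proj_smult clifford_proj_closed)
    show "(a \<oplus>\<^bsub>class_ring\<^esub> b) \<odot>\<^bsub>C\<^esub> X = a \<odot>\<^bsub>C\<^esub> X \<oplus>\<^bsub>C\<^esub> b \<odot>\<^bsub>C\<^esub> X"
      using x by (simp add: closed clifford_proj_smult clifford_proj_add distrib_right single_add)
    show "(a \<otimes>\<^bsub>class_ring\<^esub> b) \<odot>\<^bsub>C\<^esub> X = a \<odot>\<^bsub>C\<^esub> (b \<odot>\<^bsub>C\<^esub> X)"
      using x by (simp add: closed clifford_proj_smult mult.assoc[symmetric] mult_single)
    show "\<one>\<^bsub>class_ring\<^esub> \<odot>\<^bsub>C\<^esub> X = X"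
      using x by (simp add: clifford_proj_smult)
  qed
  then show ?thesis
    using field by (simp add: vectorspace_def)
qed

end

lemma clifford_relation:
  fixes v :: "'a::field vec"
  assumes v: "v \<in> carrier_vec (r + s)"
  shows "clifford_vec r s v \<otimes>\<^bsub>clifford_algebra TYPE('a) r s\<^esub> clifford_vec r s v =
    (- bilin_form r s v v) \<odot>\<^bsub>clifford_algebra TYPE('a) r s\<^esub> \<one>\<^bsub>clifford_algebra TYPE('a) r s\<^esub>"
proof -
  let ?T = "tensor_algebra TYPE('a) (r + s)" and ?I = "clifford_ideal TYPE('a) r s"
  let ?Q = "bilin_form r s v v" and ?v = "tensor_vec v"
  interpret T: ring ?T by (rule tensor_algebra_ring)
  interpret I: ideal ?I ?T by (rule clifford_ideal)
  have v': "?v \<in> carrier ?T" using v by (rule tensor_vec_closed)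
  have "?v * ?v + Poly_Mapping.single 0 ?Q \<in> ?I"
    unfolding clifford_ideal_def Let_def genideal_def using v
    by (auto simp: tensor_algebra_simps)
  moreover have "?v * ?v = (?v * ?v + Poly_Mapping.single 0 ?Q) + Poly_Mapping.single 0 (- ?Q)"
    by (simp add: single_uminus)
  ultimately have "?v * ?v \<in> ?I +>\<^bsub>?T\<^esub> Poly_Mapping.single 0 (- ?Q)"
    unfolding a_r_coset_def' tensor_algebra_simps(5) by blast
  then have "?I +>\<^bsub>?T\<^esub> (?v * ?v) = ?I +>\<^bsub>?T\<^esub> Poly_Mapping.single 0 (- ?Q)"
    using T.a_repr_independence[OF _ tensor_algebra_scalar I.a_subgroup] by metis
  moreover have "1 \<in> carrier ?T"
    using T.one_closed by (simp only: tensor_algebra_simps(3))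
  ultimately show ?thesis
    unfolding clifford_vec_def using v'
    by (simp add: clifford_proj_mult clifford_proj_one clifford_proj_smult)
qed

end

theory Submission
  imports Defs
begin

text \<open>
  The reflection \<open>\<beta>\<close> is diagonal in the canonical basis, so it extends to the tensor algebra by
  scaling each basis word by \<open>(-1)\<^sup>k\<close>, where \<open>k\<close> counts the letters with negative square norm.
  This sign is multiplicative in the word, whence the extension is an algebra homomorphism, and it
  is an involution. Since \<open>\<beta>\<close> is an isometry, the generators of the Clifford ideal are permuted,
  and the extension descends to an automorphism of the quotient, which acts on cosets by taking
  direct images.
\<close>

section \<open>Rescaling coefficients in a monoid algebra, and the sign character of words\<close>

definition twist :: "('m \<Rightarrow> 'a) \<Rightarrow> ('m \<Rightarrow>\<^sub>0 'a) \<Rightarrow> 'm \<Rightarrow>\<^sub>0 'a::comm_semiring_1" where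
  "twist \<chi> = Poly_Mapping.mapp (\<lambda>w c. \<chi> w * c)"

lemma lookup_twist: "Poly_Mapping.lookup (twist \<chi> x) w = \<chi> w * Poly_Mapping.lookup x w"
  by (simp add: twist_def lookup_mapp when_def in_keys_iff)

lemma keys_twist_subset: "Poly_Mapping.keys (twist \<chi> x) \<subseteq> Poly_Mapping.keys x"
  unfolding twist_def by (rule keys_mapp_subset)

lemma twist_zero: "twist \<chi> 0 = 0"
  by (rule poly_mapping_eqI) (simp add: lookup_twist)

lemma twist_add: "twist \<chi> (x + y) = twist \<chi> x + twist \<chi> y"
  by (rule poly_mapping_eqI) (simp add: lookup_twist lookup_add distrib_left)

lemma twist_sum: "twist \<chi> (\<Sum>i\<in>A. f i) = (\<Sum>i\<in>A. twist \<chi> (f i))"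
  by (induction A rule: infinite_finite_induct) (simp_all add: twist_zero twist_add)

lemma twist_single: "twist \<chi> (Poly_Mapping.single w c) = Poly_Mapping.single w (\<chi> w * c)"
  by (rule poly_mapping_eqI) (auto simp: lookup_twist lookup_single when_def)

lemma twist_twist: "twist \<chi> (twist \<psi> x) = twist (\<lambda>w. \<chi> w * \<psi> w) x"
  by (rule poly_mapping_eqI) (simp add: lookup_twist mult.assoc)

lemma twist_id: "twist (\<lambda>w. 1) x = x"
  by (rule poly_mapping_eqI) (simp add: lookup_twist)

lemma twist_mult:
  \<comment> \<open>The coefficient of a product at \<open>w\<close> sums over the factorizations
    \<open>w = l + q\<close>, and for each of them \<open>\<chi> w\<close> splits into one factor
    for \<open>x\<close> and one for \<open>y\<close>.\<close>
  fixes \<chi> :: "'m::monoid_add \<Rightarrow> 'a::comm_semiring_1"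
  assumes \<chi>: "\<And>u v. \<chi> (u + v) = \<chi> u * \<chi> v"
  shows "twist \<chi> (x * y) = twist \<chi> x * twist \<chi> y"
proof (rule poly_mapping_eqI)
  fix w
  let ?X = "Poly_Mapping.lookup x" and ?Y = "Poly_Mapping.lookup y"
  have inner: "\<chi> w * (\<Sum>q. ?Y q when w = l + q) = \<chi> l * (\<Sum>q. \<chi> q * ?Y q when w = l + q)" for l
  proof -
    have "\<chi> w * (\<Sum>q. ?Y q when w = l + q) = (\<Sum>q. \<chi> w * (?Y q when w = l + q))"
      \<comment> \<open>Distributing over \<open>Sum_any\<close> needs finitely many nonzero terms;
        here they lie in the support of \<open>y\<close>.\<close>
      by (rule Sum_any_right_distrib)
        (rule finite_subset[OF _ finite_lookup[of y]], auto simp: when_def)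
    also have "\<dots> = (\<Sum>q. \<chi> l * (\<chi> q * ?Y q when w = l + q))"
      by (rule Sum_any.cong) (auto simp: when_def \<chi> mult.assoc)
    also have "\<dots> = \<chi> l * (\<Sum>q. \<chi> q * ?Y q when w = l + q)"
      by (rule Sum_any_right_distrib[symmetric])
        (rule finite_subset[OF _ finite_lookup[of y]], auto simp: when_def)
    finally show ?thesis .
  qed
  have "\<chi> w * (\<Sum>l. ?X l * (\<Sum>q. ?Y q when w = l + q)) =
      (\<Sum>l. \<chi> w * (?X l * (\<Sum>q. ?Y q when w = l + q)))"
    by (rule Sum_any_right_distrib) (rule finite_subset[OF _ finite_lookup[of x]], auto)
  also have "\<dots> = (\<Sum>l. ?X l * (\<chi> w * (\<Sum>q. ?Y q when w = l + q)))"
    by (simp only: mult.left_commute)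
  also have "\<dots> = (\<Sum>l. (\<chi> l * ?X l) * (\<Sum>q. \<chi> q * ?Y q when w = l + q))"
    unfolding inner by (simp only: mult.assoc mult.left_commute)
  finally show "Poly_Mapping.lookup (twist \<chi> (x * y)) w =
      Poly_Mapping.lookup (twist \<chi> x * twist \<chi> y) w"
    by (simp add: lookup_twist lookup_mult)
qed

text \<open>Letters start at 0, so among the letters below \<open>r + s\<close> those with
  \<open>r \<le> i\<close> are the basis vectors on which the form is -1.\<close>

definition word_sign :: "nat \<Rightarrow> word \<Rightarrow> 'a::comm_ring_1" where
  "word_sign r w = (- 1) ^ length (filter (\<lambda>i. r \<le> i) (letters w))"

lemma word_sign_zero: "word_sign r 0 = 1"
  by (simp add: word_sign_def zero_word_def)

lemma word_sign_add: "word_sign r (u + v) = word_sign r u * word_sign r v"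
  by (simp add: word_sign_def plus_word_def power_add)

lemma word_sign_square: "word_sign r w * word_sign r w = 1"
  by (simp add: word_sign_def flip: power_mult_distrib)

section \<open>The reflection on coordinate vectors\<close>

definition reflect_vec :: "nat \<Rightarrow> 'a::comm_ring_1 vec \<Rightarrow> 'a vec" where
  "reflect_vec r v = vec (dim_vec v) (\<lambda>i. if i < r then v $ i else - v $ i)"

lemma reflect_vec_closed: "v \<in> carrier_vec n \<Longrightarrow> reflect_vec r v \<in> carrier_vec n"
  by (auto simp: reflect_vec_def)

text \<open>Coordinates enter \<open>bilin_form r s v v\<close> only through their squares, so sign
  changes cancel.\<close>

lemma bilin_form_reflect_vec:
  assumes "v \<in> carrier_vec (r + s)"
  shows "bilin_form r s (reflect_vec r v) (reflect_vec r v) = bilin_form r s v v"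
  using assms by (simp add: bilin_form_def reflect_vec_def)

text \<open>A linear map is determined by its values on the basis; this replaces an arbitrary
  \<beta> by its coordinate formula.\<close>

lemma linear_map_eq_reflect_vec:
  fixes \<beta> :: "'a::field vec \<Rightarrow> 'a vec"
  assumes lin: "linear_map class_ring (module_vec TYPE('a) n) (module_vec TYPE('a) n) \<beta>"
    and fixed: "\<And>i. i < r \<Longrightarrow> i < n \<Longrightarrow> \<beta> (unit_vec n i) = unit_vec n i"
    and negated: "\<And>i. r \<le> i \<Longrightarrow> i < n \<Longrightarrow> \<beta> (unit_vec n i) = - unit_vec n i"
    and v: "v \<in> carrier_vec n"
  shows "\<beta> v = reflect_vec r v"
proof -
  interpret linear_map class_ring "module_vec TYPE('a) n" "module_vec TYPE('a) n" \<beta> by (rule lin)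
  have add: "\<beta> (u + w) = \<beta> u + \<beta> w" if "u \<in> carrier_vec n" "w \<in> carrier_vec n" for u w
    using f_add[of u w] that by (simp add: module_vec_simps)
  have smult: "\<beta> (c \<cdot>\<^sub>v u) = c \<cdot>\<^sub>v \<beta> u" if "u \<in> carrier_vec n" for c u
    using f_smult[of c u] that by (simp add: module_vec_simps class_ring_simps)
  have unit: "\<beta> (unit_vec n i) = reflect_vec r (unit_vec n i)" if "i < n" for i
    using that fixed[of i] negated[of i]
    by (cases "i < r") (auto simp: reflect_vec_def intro!: eq_vecI)
  \<comment> \<open>Truncation to the first \<open>k\<close> coordinates: each induction step adds
    one multiple of a basis vector, and \<open>cut n\<close> is \<open>v\<close> itself.\<close>
  define cut where "cut k = vec n (\<lambda>i. if i < k then v $ i else 0)" for k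
  have "\<beta> (cut k) = reflect_vec r (cut k)" if "k \<le> n" for k
    using that
  proof (induction k)
    case 0
    \<comment> \<open>Written as a multiple by the scalar 0, the zero vector is sent to zero by
      homogeneity alone.\<close>
    have "cut 0 = 0 \<cdot>\<^sub>v 0\<^sub>v n"
      by (auto simp: cut_def)
    then have "\<beta> (cut 0) = 0 \<cdot>\<^sub>v \<beta> (0\<^sub>v n)"
      by (simp only: smult[OF zero_carrier_vec])
    \<comment> \<open>This fixes the dimension: 0 times \<beta> of the zero vector is
      \<open>0\<^sub>v n\<close> only if that value has dimension \<open>n\<close>.\<close>
    moreover have "\<beta> (0\<^sub>v n) \<in> carrier_vec n"
      using f_hom by (auto simp: LinearCombinations.module_hom_def module_vec_simps)
    ultimately show ?case
      by (auto simp: reflect_vec_def cut_def)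
  next
    case (Suc k)
    have "cut (Suc k) = cut k + v $ k \<cdot>\<^sub>v unit_vec n k"
      using Suc.prems by (auto simp: cut_def less_Suc_eq intro!: eq_vecI)
    then have "\<beta> (cut (Suc k)) = reflect_vec r (cut k) + v $ k \<cdot>\<^sub>v reflect_vec r (unit_vec n k)"
      using Suc unit[of k] by (simp add: add smult cut_def)
    also have "\<dots> = reflect_vec r (cut (Suc k))"
      using Suc.prems by (auto simp: reflect_vec_def cut_def less_Suc_eq intro!: eq_vecI)
    finally show ?case .
  qed
  moreover have "cut n = v"
    using v by (auto simp: cut_def)
  ultimately show ?thesis
    by auto
qed

section \<open>Extension to the tensor algebra and invariance of the Clifford ideal\<close>

definition reflect_tensor :: "nat \<Rightarrow> (word \<Rightarrow>\<^sub>0 'a) \<Rightarrow> word \<Rightarrow>\<^sub>0 'a::comm_ring_1" where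
  "reflect_tensor r = twist (word_sign r)"

lemma reflect_tensor_add: "reflect_tensor r (x + y) = reflect_tensor r x + reflect_tensor r y"
  unfolding reflect_tensor_def by (rule twist_add)

lemma reflect_tensor_mult: "reflect_tensor r (x * y) = reflect_tensor r x * reflect_tensor r y"
  unfolding reflect_tensor_def by (rule twist_mult) (rule word_sign_add)

lemma reflect_tensor_scalar: "reflect_tensor r (Poly_Mapping.single 0 c) = Poly_Mapping.single 0 c"
  by (simp add: reflect_tensor_def twist_single word_sign_zero)

lemma reflect_tensor_one: "reflect_tensor r 1 = 1"
  using reflect_tensor_scalar[of r 1] by simp

lemma reflect_tensor_involution: "reflect_tensor r (reflect_tensor r x) = x"
  by (simp add: reflect_tensor_def twist_twist word_sign_square twist_id)

text \<open>This is the sense in which the map extends the reflection: a one-letter word has sign 1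
  or -1 according to whether its letter is below \<open>r\<close>.\<close>

lemma reflect_tensor_vec: "reflect_tensor r (tensor_vec v) = tensor_vec (reflect_vec r v)"
  for v :: "'a::field vec"
  unfolding reflect_tensor_def tensor_vec_def twist_sum
  by (rule sum.cong) (auto simp: twist_single reflect_vec_def word_sign_def)

lemma reflect_tensor_closed:
  assumes "x \<in> carrier (tensor_algebra ty n)"
  shows "reflect_tensor r x \<in> carrier (tensor_algebra ty n)"
  using assms keys_twist_subset[of "word_sign r" x]
  by (auto simp: reflect_tensor_def tensor_algebra_simps)

lemma reflect_tensor_ring_hom:
  "ring_hom_ring (tensor_algebra ty n) (tensor_algebra ty n) (reflect_tensor r)"
  by (rule ring_hom_ringI[OF tensor_algebra_ring tensor_algebra_ring])
    (simp_all add: reflect_tensor_closed, simp_all add: tensor_algebra_simps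
      reflect_tensor_add reflect_tensor_mult reflect_tensor_one)

text \<open>The preimage of the ideal under the homomorphism is an ideal containing all generators,
  hence contains the Clifford ideal by minimality. The involution turns this inclusion into
  equality.\<close>

lemma reflect_tensor_clifford_ideal:
  fixes ty :: "'a::field itself"
  shows "reflect_tensor r ` clifford_ideal ty r s = clifford_ideal ty r s"
proof -
  let ?T = "tensor_algebra ty (r + s)" and ?I = "clifford_ideal ty r s"
  let ?g = "\<lambda>v. tensor_vec v \<otimes>\<^bsub>?T\<^esub> tensor_vec v \<oplus>\<^bsub>?T\<^esub> bilin_form r s v v \<odot>\<^bsub>?T\<^esub> \<one>\<^bsub>?T\<^esub>"
  interpret T: ring ?T by (rule tensor_algebra_ring)
  interpret I: ideal ?I ?T by (rule clifford_ideal)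
  have g_eq: "?g v = tensor_vec v * tensor_vec v + Poly_Mapping.single 0 (bilin_form r s v v)" for v
    by (simp add: tensor_algebra_simps)
  have g: "?g v \<in> ?I" if "v \<in> carrier_vec (r + s)" for v
    using that unfolding clifford_ideal_def Let_def genideal_def by blast
  have "ideal {x \<in> carrier ?T. reflect_tensor r x \<in> ?I} ?T"
    by (rule ring_hom_ring.ideal_vimage[OF reflect_tensor_ring_hom I.ideal_axioms])
  moreover have "?g v \<in> {x \<in> carrier ?T. reflect_tensor r x \<in> ?I}" if v: "v \<in> carrier_vec (r + s)" for v
  proof -
    \<comment> \<open>The isometry property makes the scalar part agree, so the generator of
      \<open>v\<close> goes to the generator of the reflected vector.\<close>
    have "reflect_tensor r (?g v) = ?g (reflect_vec r v)"
      unfolding g_eq using v by (simp only: reflect_tensor_add reflect_tensor_mult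
          reflect_tensor_vec reflect_tensor_scalar bilin_form_reflect_vec)
    with g[OF v] g[OF reflect_vec_closed[OF v]] I.a_subset show ?thesis
      by auto
  qed
  ultimately have "?I \<subseteq> {x \<in> carrier ?T. reflect_tensor r x \<in> ?I}"
    unfolding clifford_ideal_def[of ty r s] Let_def
    by (intro T.genideal_minimal) (auto simp: clifford_ideal_def Let_def)
  then have sub: "reflect_tensor r x \<in> ?I" if "x \<in> ?I" for x
    using that by blast
  \<comment> \<open>The preimage of \<open>x\<close> is its own reflection, which lies in the ideal
    by \<open>sub\<close>.\<close>
  have "x \<in> reflect_tensor r ` ?I" if "x \<in> ?I" for x
    using sub[OF that] reflect_tensor_involution[of r x] by (metis imageI)
  with sub show ?thesis
    by blast
qed

section \<open>Descent to the Clifford algebra\<close>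

text \<open>Since the ideal is mapped onto itself, the direct image of a coset is a full coset. Thus
  taking images is the induced map on the quotient, with no choice of representatives.\<close>

lemma reflect_tensor_coset:
  "reflect_tensor r ` (clifford_ideal ty r s +>\<^bsub>tensor_algebra ty (r + s)\<^esub> x) =
    clifford_ideal ty r s +>\<^bsub>tensor_algebra ty (r + s)\<^esub> reflect_tensor r x"
proof -
  have "reflect_tensor r ` (clifford_ideal ty r s +>\<^bsub>tensor_algebra ty (r + s)\<^esub> x) =
      (\<Union>h\<in>reflect_tensor r ` clifford_ideal ty r s. {h + reflect_tensor r x})"
    by (simp add: a_r_coset_def' tensor_algebra_simps reflect_tensor_add image_UN)
  then show ?thesis
    by (simp add: reflect_tensor_clifford_ideal a_r_coset_def' tensor_algebra_simps)
qed

lemma reflect_clifford_ring_iso: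
  fixes ty :: "'a::field itself"
  shows "image (reflect_tensor r) \<in> ring_iso (clifford_algebra ty r s) (clifford_algebra ty r s)"
    (is "?\<phi> \<in> ring_iso ?C ?C")
proof -
  let ?T = "tensor_algebra ty (r + s)"
  interpret T: ring ?T by (rule tensor_algebra_ring)
  have closed: "?\<phi> X \<in> carrier ?C" if "X \<in> carrier ?C" for X
    using that
    by (metis clifford_carrierE clifford_proj_closed reflect_tensor_closed reflect_tensor_coset)
  have add_closed: "x + y \<in> carrier ?T" if "x \<in> carrier ?T" "y \<in> carrier ?T" for x y
    using T.a_closed[OF that] by (simp only: tensor_algebra_simps(5))
  have "?\<phi> \<in> Ring.ring_hom ?C ?C"
  proof (rule ring_hom_memI)
    fix X Y assume "X \<in> carrier ?C" "Y \<in> carrier ?C"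
    then obtain x y where xy: "x \<in> carrier ?T" "X = clifford_ideal ty r s +>\<^bsub>?T\<^esub> x"
      "y \<in> carrier ?T" "Y = clifford_ideal ty r s +>\<^bsub>?T\<^esub> y"
      using clifford_carrierE by metis
    note simps = clifford_proj_mult clifford_proj_add reflect_tensor_coset reflect_tensor_closed
      reflect_tensor_mult reflect_tensor_add
    show "?\<phi> (X \<otimes>\<^bsub>?C\<^esub> Y) = ?\<phi> X \<otimes>\<^bsub>?C\<^esub> ?\<phi> Y" "?\<phi> (X \<oplus>\<^bsub>?C\<^esub> Y) = ?\<phi> X \<oplus>\<^bsub>?C\<^esub> ?\<phi> Y"
      using xy by (simp_all add: simps)
  qed (simp_all add: closed clifford_proj_one reflect_tensor_coset reflect_tensor_one)
  \<comment> \<open>Images under an involution again form an involution, so the map serves as its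
    own inverse.\<close>
  moreover have "?\<phi> (?\<phi> X) = X" for X
    by (simp add: image_image reflect_tensor_involution)
  then have "bij_betw ?\<phi> (carrier ?C) (carrier ?C)"
    using closed by (intro bij_betwI[where g = ?\<phi>]) auto
  ultimately show ?thesis
    by (simp add: ring_iso_def)
qed

text \<open>\<open>ring_iso\<close> says nothing about scalars. A scalar acts as multiplication by
  \<open>Poly_Mapping.single 0 c\<close>, which is fixed because the empty word has sign 1.\<close>

lemma reflect_clifford_linear_map:
  fixes ty :: "'a::field itself"
  shows "linear_map class_ring (clifford_algebra ty r s) (clifford_algebra ty r s)
    (image (reflect_tensor r))" (is "linear_map _ ?C _ ?\<phi>")
proof -
  interpret C: vectorspace class_ring ?C by (rule clifford_algebra_vectorspace)
  have hom: "?\<phi> \<in> Ring.ring_hom ?C ?C"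
    using reflect_clifford_ring_iso[of r ty s] by (simp add: ring_iso_def)
  have "?\<phi> (c \<odot>\<^bsub>?C\<^esub> X) = c \<odot>\<^bsub>?C\<^esub> ?\<phi> X" if X: "X \<in> carrier ?C" for c X
  proof -
    obtain x where "x \<in> carrier (tensor_algebra ty (r + s))"
      "X = clifford_ideal ty r s +>\<^bsub>tensor_algebra ty (r + s)\<^esub> x"
      using X clifford_carrierE by metis
    then show ?thesis
      by (simp add: clifford_proj_smult reflect_tensor_coset reflect_tensor_closed
          reflect_tensor_mult reflect_tensor_scalar)
  qed
  then have "?\<phi> \<in> LinearCombinations.module_hom class_ring ?C ?C"
    using ring_hom_closed[OF hom] ring_hom_add[OF hom]
    by (simp add: LinearCombinations.module_hom_def)
  then show ?thesis
    by (simp add: linear_map_def mod_hom_def mod_hom_axioms_def C.vectorspace_axioms C.module_axioms)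
qed

theorem proposition2p1:
  fixes r s n :: nat and \<beta> :: "'a::field vec \<Rightarrow> 'a vec"
  assumes "CHAR('a) \<noteq> 2"
    and "s > 0" and "n = r + s"
    and "linear_map class_ring (module_vec TYPE('a) n) (module_vec TYPE('a) n) \<beta>"
    and "\<And>i. i < r \<Longrightarrow> \<beta> (unit_vec n i) = unit_vec n i"
    and "\<And>j. j < s \<Longrightarrow> \<beta> (unit_vec n (r + j)) = - unit_vec n (r + j)"
  shows "\<exists>\<phi> \<in> ring_iso (clifford_algebra TYPE('a) r s) (clifford_algebra TYPE('a) r s).
    linear_map class_ring (clifford_algebra TYPE('a) r s) (clifford_algebra TYPE('a) r s) \<phi> \<and>
    (\<forall>v \<in> carrier_vec n. \<phi> (clifford_vec r s v) = clifford_vec r s (\<beta> v))"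
proof (intro bexI[OF _ reflect_clifford_ring_iso] conjI ballI)
  fix v :: "'a vec" assume v: "v \<in> carrier_vec n"
  \<comment> \<open>The hypothesis numbers the negated basis vectors as \<open>r + j\<close> with
    \<open>j < s\<close>; take \<open>j = i - r\<close>.\<close>
  have "\<beta> (unit_vec n i) = - unit_vec n i" if "r \<le> i" "i < n" for i
    using assms(6)[of "i - r"] that \<open>n = r + s\<close> by simp
  with assms(4,5) v have "\<beta> v = reflect_vec r v"
    by (intro linear_map_eq_reflect_vec) auto
  then show "reflect_tensor r ` clifford_vec r s v = clifford_vec r s (\<beta> v)"
    by (simp add: clifford_vec_def reflect_tensor_coset reflect_tensor_vec)
qed (rule reflect_clifford_linear_map)

end
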